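(* Let $B>S>0$ be integers, let $G=\sum_{k\ge0}(-1)^k(2k+1)^{-2}$ be Catalan's constant, and let $A\subset\{0,\dots,S+2\}$ be an $S$-element set with $\det\mathcal R[A,J](G)\ne0$. Then $$\sum_{p\ \mathrm{odd\ prime},\ \nu\ge1}\bigl(a_{p^\nu,B}-m^A_{p^\nu,B}\bigr)\log p+\log|\widehat q_B(G)|=\log\bigl|\det\mathcal R[A,J](G)\bigr|+v_2(F_D)\log2-\sum_{p\ \mathrm{odd\ prime},\ \nu\ge1}m^A_{p^\nu,B}\log p .$$ Moreover $v_2(F_D)=\sum_{r=0}^{2B-1}\bigl(r-s_2(r)\bigr)=2B^2+O(B\log B)$ as $B\to\infty$, where $s_2(r)$ is the sum of the binary digits of $r$; thus $v_2(F_D)\log 2=(2\log2)B^2+O(B\log B)$.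
   Context: Logarithms are natural; $v_p$ is the $p$-adic valuation. For integers $m\ge 0$ put $S_{m-1}=\sum_{k=0}^{m-1}\frac{(-1)^k}{(2k+1)^2}$ and $u_m(t)=\frac{(-1)^m(t-S_{m-1})}{2m+1}\in\mathbb Q[t]$. For integers $B>S>0$ let $\Pi_i=\prod_{h=1}^{B}\bigl(2(h+i)+1\bigr)^2$ ($i\ge0$), and for $0\le a\le S+2$, $1\le j\le S$ let $$\mathcal R_{a,j}(t)=\sum_{i=0}^{a+2B}(-1)^i\binom{a+2B}{i}\Pi_i\,u_{i+j}(t).$$ Put $J=\{1,\dots,S\}$, $D=2B$, $N=2B+S+3$, $F_D=\prod_{r=0}^{2B-1}r!$. For an $S$-element set $A\subset\{0,\dots,S+2\}$ write $\mathcal R[A,J](t)=(\mathcal R_{a,j}(t))_{a\in A,\,j\in J}$ and define (up to a sign, which is irrelevant here) $\widehat q_B(t)=\pm F_D\det\mathcal R[A,J](t)/\prod_{i=0}^{N-1}\Pi_i\in\mathbb Q[t]$. For an odd prime power $Q$ put $\Phi_Q(n)=\sum_{r=0}^{n-1}\lfloor r/Q\rfloor$, $N_{K,Q}(i)=\#\{1\le h\le K: Q\mid 2i+2h+1\}$, $C^A_Q=\sum_{a\in A}\lfloor(a+2B)/Q\rfloor$, $F_{N,Q}(i)=\lfloor i/Q\rfloor+\lfloor(N-1-i)/Q\rfloor$, and, for $I\subset\{0,\dots,N-1\}$, $n_{Q,r}(I)=\#\{i\in I:i\equiv r\pmod Q\}$. Define $$\lambda^A_Q(I)=C^A_Q+2\sum_{r\bmod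 Q}\binom{n_{Q,r}(I)}2+\sum_{i\in I}\Bigl(2N_{B,Q}(i)-N_{S,Q}(i)-2\cdot\mathbf 1_{Q\le2i+1}-F_{N,Q}(i)\Bigr),$$ $$m^A_{Q,B}=\min_{I\subset\{0,\dots,N-1\},\,|I|=S}\lambda^A_Q(I),\qquad a_{Q,B}=2\sum_{i=0}^{N-1}N_{B,Q}(i)-\Phi_Q(D),$$ where $\mathbf 1_{Q\le 2i+1}$ is $1$ if $Q\le2i+1$ and $0$ otherwise. For fixed $B,S,A$ only finitely many odd prime powers $Q$ have $a_{Q,B}\ne0$ or $m^A_{Q,B}\neq0$, so the sums are finite. *)

theory Defs
  imports
    "HOL-Analysis.Infinite_Sum"
    "HOL-Library.Landau_Symbols"
    "HOL-Computational_Algebra.Computational_Algebra"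
    "Jordan_Normal_Form.Determinant"
begin

definition catalan_const :: real where
  "catalan_const = (\<Sum>k. (-1) ^ k / (2 * real k + 1)\<^sup>2)"

(* The sum of the first m terms, that is S_{m-1}; the empty sum for m = 0. *)
definition catalan_partial :: "nat \<Rightarrow> rat" where
  "catalan_partial m = (\<Sum>k<m. (-1) ^ k / (2 * of_nat k + 1)\<^sup>2)"

definition u_poly :: "nat \<Rightarrow> rat poly" where
  "u_poly m = Polynomial.smult ((-1) ^ m / (2 * of_nat m + 1)) ([:0, 1:] - [:catalan_partial m:])"

definition Pi_B :: "nat \<Rightarrow> nat \<Rightarrow> nat" where
  "Pi_B B i = (\<Prod>h=1..B. (2 * (h + i) + 1)\<^sup>2)"

definition R_poly :: "nat \<Rightarrow> nat \<Rightarrow> nat \<Rightarrow> rat poly" where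
  "R_poly B a j =
     (\<Sum>i=0..a + 2 * B.
        Polynomial.smult ((-1) ^ i * of_nat ((a + 2 * B) choose i) * of_nat (Pi_B B i)) (u_poly (i + j)))"

definition N_BS :: "nat \<Rightarrow> nat \<Rightarrow> nat" where
  "N_BS B S = 2 * B + S + 3"

definition F_fact :: "nat \<Rightarrow> nat" where
  "F_fact D = (\<Prod>r<D. fact r)"

(* Rows are indexed by the elements of A in increasing order; column c (counted from 0)
   belongs to j = c + 1. *)
definition R_mat :: "nat \<Rightarrow> nat \<Rightarrow> nat set \<Rightarrow> rat poly mat" where
  "R_mat B S A = mat S S (\<lambda>(r, c). R_poly B (sorted_list_of_set A ! r) (c + 1))"

(* The sign s, which is 1 or -1, is the one left open in the definition of q-hat. *)
definition q_hat :: "rat \<Rightarrow> nat \<Rightarrow> nat \<Rightarrow> nat set \<Rightarrow> rat poly" where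
  "q_hat s B S A =
     Polynomial.smult (s * of_nat (F_fact (2 * B)) / (\<Prod>i<N_BS B S. of_nat (Pi_B B i)))
       (det (R_mat B S A))"

definition eval_real :: "rat poly \<Rightarrow> real \<Rightarrow> real" where
  "eval_real f x = poly (map_poly of_rat f) x"

definition Phi_Q :: "nat \<Rightarrow> nat \<Rightarrow> nat" where
  "Phi_Q Q n = (\<Sum>r<n. r div Q)"

definition N_KQ :: "nat \<Rightarrow> nat \<Rightarrow> nat \<Rightarrow> nat" where
  "N_KQ K Q i = card {h. 1 \<le> h \<and> h \<le> K \<and> Q dvd 2 * i + 2 * h + 1}"

definition C_AQ :: "nat \<Rightarrow> nat set \<Rightarrow> nat \<Rightarrow> nat" where
  "C_AQ B A Q = (\<Sum>a\<in>A. (a + 2 * B) div Q)"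

(* Only used for i < N, where the subtraction does not truncate. *)
definition F_NQ :: "nat \<Rightarrow> nat \<Rightarrow> nat \<Rightarrow> nat" where
  "F_NQ N Q i = i div Q + (N - 1 - i) div Q"

definition n_Qr :: "nat \<Rightarrow> nat \<Rightarrow> nat set \<Rightarrow> nat" where
  "n_Qr Q r I = card {i \<in> I. i mod Q = r}"

definition lambda_AQ :: "nat \<Rightarrow> nat \<Rightarrow> nat set \<Rightarrow> nat \<Rightarrow> nat set \<Rightarrow> int" where
  "lambda_AQ B S A Q I =
     int (C_AQ B A Q) + 2 * (\<Sum>r<Q. int (n_Qr Q r I choose 2)) +
     (\<Sum>i\<in>I. 2 * int (N_KQ B Q i) - int (N_KQ S Q i) - 2 * of_bool (Q \<le> 2 * i + 1)
             - int (F_NQ (N_BS B S) Q i))"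

definition m_AQ :: "nat \<Rightarrow> nat \<Rightarrow> nat set \<Rightarrow> nat \<Rightarrow> int" where
  "m_AQ B S A Q = Min (lambda_AQ B S A Q ` {I. I \<subseteq> {..<N_BS B S} \<and> card I = S})"

definition a_Q :: "nat \<Rightarrow> nat \<Rightarrow> nat \<Rightarrow> int" where
  "a_Q B S Q = 2 * (\<Sum>i<N_BS B S. int (N_KQ B Q i)) - int (Phi_Q Q (2 * B))"

definition odd_prime_exps :: "(nat \<times> nat) set" where
  "odd_prime_exps = {(p, \<nu>). prime p \<and> odd p \<and> \<nu> \<ge> 1}"

fun binary_digit_sum :: "nat \<Rightarrow> nat" where
  "binary_digit_sum r = (if r = 0 then 0 else r mod 2 + binary_digit_sum (r div 2))"

declare binary_digit_sum.simps [simp del]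

(* By the following facts, sums of a_Q and m_AQ over odd_prime_exps have finite support,
   so that infsum does not take its default value on them. *)

lemma N_KQ_eq_0: "N_KQ K Q i = 0" if "Q > 2 * i + 2 * K + 1"
proof -
  have "{h. 1 \<le> h \<and> h \<le> K \<and> Q dvd 2 * i + 2 * h + 1} = {}"
    using that by (auto dest!: dvd_imp_le)
  then show ?thesis by (simp only: N_KQ_def card.empty)
qed

lemma a_Q_eq_0: "a_Q B S Q = 0" if "Q > 2 * N_BS B S + 2 * B"
proof -
  have "N_KQ B Q i = 0" if "i < N_BS B S" for i
    using that \<open>Q > _\<close> by (intro N_KQ_eq_0) simp
  moreover have "Phi_Q Q (2 * B) = 0"
    using that by (auto simp: Phi_Q_def N_BS_def)
  ultimately show ?thesis by (simp add: a_Q_def)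
qed

lemma lambda_AQ_eq_0:
  assumes Q: "Q > 2 * N_BS B S + 2 * B + 2 * S" and A: "A \<subseteq> {0..S + 2}"
    and I: "I \<subseteq> {..<N_BS B S}"
  shows "lambda_AQ B S A Q I = 0"
proof -
  have fin: "finite I" using I finite_subset by blast
  have "C_AQ B A Q = 0"
    unfolding C_AQ_def using A Q by (intro sum.neutral) (auto simp: N_BS_def)
  moreover have "n_Qr Q r I choose 2 = 0" for r
  proof -
    have "{i \<in> I. i mod Q = r} \<subseteq> {r}" using I Q by (auto simp: subset_iff)
    then have "n_Qr Q r I \<le> 1" unfolding n_Qr_def
      using card_mono[of "{r}" "{i \<in> I. i mod Q = r}"] by simp
    then show ?thesis by simp
  qed
  moreover have "N_KQ B Q i = 0" "N_KQ S Q i = 0" "\<not> Q \<le> 2 * i + 1" "F_NQ (N_BS B S) Q i = 0"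
    if "i \<in> I" for i
  proof -
    have "i < N_BS B S" using that I by auto
    then show "N_KQ B Q i = 0" "N_KQ S Q i = 0" "\<not> Q \<le> 2 * i + 1" "F_NQ (N_BS B S) Q i = 0"
      using Q by (auto intro!: N_KQ_eq_0 simp: F_NQ_def)
  qed
  ultimately show ?thesis by (simp add: lambda_AQ_def binomial_eq_0)
qed

lemma m_AQ_eq_0:
  assumes Q: "Q > 2 * N_BS B S + 2 * B + 2 * S" and A: "A \<subseteq> {0..S + 2}"
  shows "m_AQ B S A Q = 0"
proof -
  let ?X = "{I. I \<subseteq> {..<N_BS B S} \<and> card I = S}"
  have "{..<S} \<in> ?X" by (auto simp: N_BS_def)
  then have "?X \<noteq> {}" by blast
  moreover have "lambda_AQ B S A Q I = 0" if "I \<in> ?X" for I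
    using that by (intro lambda_AQ_eq_0[OF Q A]) simp
  ultimately have "lambda_AQ B S A Q ` ?X = {0}"
    by (simp add: image_constant_conv cong: image_cong_simp)
  then show ?thesis by (simp add: m_AQ_def)
qed

lemma finite_support:
  assumes A: "A \<subseteq> {0..S + 2}"
  shows "finite {(p, \<nu>) \<in> odd_prime_exps. a_Q B S (p ^ \<nu>) \<noteq> 0 \<or> m_AQ B S A (p ^ \<nu>) \<noteq> 0}"
proof (rule finite_subset)
  let ?K = "2 * N_BS B S + 2 * B + 2 * S"
  show "finite ({..?K} \<times> {..?K})" by simp
  show "{(p, \<nu>) \<in> odd_prime_exps. a_Q B S (p ^ \<nu>) \<noteq> 0 \<or> m_AQ B S A (p ^ \<nu>) \<noteq> 0}
          \<subseteq> {..?K} \<times> {..?K}"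
  proof (clarsimp simp only: odd_prime_exps_def mem_Sigma_iff atMost_iff mem_Collect_eq
      case_prod_conv)
    fix p \<nu> :: nat
    assume p: "prime p" and \<nu>: "1 \<le> \<nu>"
      and nz: "a_Q B S (p ^ \<nu>) \<noteq> 0 \<or> m_AQ B S A (p ^ \<nu>) \<noteq> 0"
    have le: "p ^ \<nu> \<le> ?K"
      using nz a_Q_eq_0[of B S "p ^ \<nu>"] m_AQ_eq_0[OF _ A, of B "p ^ \<nu>"]
      by (meson not_le le_add1 le_less_trans)
    have p2: "p \<ge> 2" using p by (rule prime_ge_2_nat)
    have "p \<le> p ^ \<nu>" using p2 \<nu> by (intro self_le_power) auto
    moreover have "\<nu> < p ^ \<nu>" using p2 by (intro power_gt_expt) auto
    ultimately show "p \<le> ?K \<and> \<nu> \<le> ?K" using le by linarith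
  qed
qed

end

theory Submission
  imports Defs
begin

text \<open>
  Taking logarithms in the definition of \<open>q_hat\<close>, whose sign disappears under the absolute value,
  leaves the terms \<open>ln F_D - \<Sum> ln \<Pi>_i\<close> to be compared with \<open>\<Sum> a_Q ln p\<close>
  (the sum of the \<open>m_Q ln p\<close> occurs on both sides). Both \<open>F_D\<close> and \<open>\<Pi>_i\<close> are products of small
  integers \<open>n\<close>, and for each of these
  \<open>ln n - v_2(n) ln 2\<close> is the sum of \<open>ln p\<close> over the odd prime powers \<open>p^\<nu>\<close> dividing \<open>n\<close>
  (\<open>ln_eq_sum_odd_prime_powers\<close>). Exchanging the two sums, a prime power \<open>Q\<close> is weighted by
  the number of factors that it divides. In \<open>fact r\<close> these are \<open>r div Q\<close> factors, which produces
  \<open>Phi_Q\<close> (\<open>ln_F_fact\<close>). In \<open>\<Pi>_i\<close>, a product of squares of odd numbers without contribution from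
  \<open>2\<close>, they number \<open>2 N_{B,Q}(i)\<close> (\<open>ln_Pi_B\<close>). The difference is exactly \<open>a_Q\<close>.

  The asymptotic statement rests on Legendre's formula \<open>v_2(r!) = r - s_2(r)\<close> together with
  \<open>2 ^ s_2(r) \<le> r + 1\<close>: summing over \<open>r < 2 B\<close> gives \<open>B (2 B - 1)\<close> up to \<open>2 B log_2 (2 B)\<close>.
\<close>

section \<open>Logarithms as sums over odd prime powers\<close>

text \<open>A finite box that, for large \<open>K\<close>, contains the support of all the sums involved. Each odd
  prime power \<open>p^\<nu> \<le> K\<close> lies in it because \<open>p \<le> p^\<nu>\<close> and \<open>\<nu> < p^\<nu>\<close>.\<close>

definition odd_prime_exps_upto :: "nat \<Rightarrow> (nat \<times> nat) set" where
  "odd_prime_exps_upto K = {p. prime p \<and> odd p \<and> p \<le> K} \<times> {1..K}"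

lemma finite_odd_prime_exps_upto [simp]: "finite (odd_prime_exps_upto K)"
  by (auto simp: odd_prime_exps_upto_def)

lemma sum_dvd_powers_eq_multiplicity:
  fixes p n K :: nat
  assumes "prime p" "0 < n" "n \<le> K"
  shows "(\<Sum>\<nu>=1..K. of_bool (p ^ \<nu> dvd n) :: real) = real (multiplicity p n)"
proof -
  have "multiplicity p n < p ^ multiplicity p n"
    using prime_ge_2_nat[OF assms(1)] by (intro power_gt_expt) auto
  also have "p ^ multiplicity p n \<le> n"
    using assms(2) by (intro dvd_imp_le multiplicity_dvd) auto
  finally have le: "multiplicity p n \<le> K" using assms(3) by simp
  have dvd_iff: "p ^ \<nu> dvd n \<longleftrightarrow> \<nu> \<le> multiplicity p n" for \<nu>
    using assms prime_gt_1_nat[OF assms(1)] by (intro power_dvd_iff_le_multiplicity) auto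
  have "{1..K} \<inter> {\<nu>. p ^ \<nu> dvd n} = {1..multiplicity p n}"
    unfolding dvd_iff using le by auto
  then show ?thesis
    by (simp add: sum.If_cases of_bool_def)
qed

text \<open>The identity \<open>ln n = \<Sum>_{d | n} \<Lambda>(d)\<close> for von Mangoldt's function \<open>\<Lambda>\<close>, with the powers of \<open>2\<close>
  collected separately.\<close>

lemma ln_eq_sum_odd_prime_powers:
  fixes n K :: nat
  assumes "0 < n" "n \<le> K"
  shows "ln (real n) = real (multiplicity 2 n) * ln 2
    + (\<Sum>(p, \<nu>)\<in>odd_prime_exps_upto K. of_bool (p ^ \<nu> dvd n) * ln (real p))"
proof -
  let ?O = "{p. prime p \<and> odd p \<and> p \<le> K}"
  let ?f = "\<lambda>p. real (multiplicity p n) * ln (real p)"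
  have fin: "finite ?O" by auto
  have "ln (real n) = ln (real (\<Prod>p\<in>prime_factors n. p ^ multiplicity p n))"
    using assms by (simp add: prod_prime_factors del: of_nat_prod)
  also have "\<dots> = (\<Sum>p\<in>prime_factors n. ln (real p ^ multiplicity p n))"
    unfolding of_nat_prod of_nat_power
    by (rule ln_prod) (auto simp: in_prime_factors_iff prime_gt_0_nat)
  also have "\<dots> = (\<Sum>p\<in>prime_factors n. ?f p)"
    by (simp only: ln_realpow)
  also have "\<dots> = (\<Sum>p\<in>insert 2 ?O. ?f p)"
  proof (intro sum.mono_neutral_left ballI)
    show "prime_factors n \<subseteq> insert 2 ?O"
    proof
      fix p assume "p \<in> prime_factors n"
      then have "prime p" "p dvd n" by (auto simp: in_prime_factors_iff)
      moreover have "p \<le> K" using dvd_imp_le[OF \<open>p dvd n\<close>] assms by simp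
      ultimately show "p \<in> insert 2 ?O"
        using primes_dvd_imp_eq[of 2 p] by auto
    qed
    fix p assume "p \<in> insert 2 ?O - prime_factors n"
    then have "\<not> p dvd n" using assms by (auto simp: in_prime_factors_iff)
    then show "?f p = 0" by (simp add: not_dvd_imp_multiplicity_0)
  qed (use fin in simp)
  also have "\<dots> = ?f 2 + (\<Sum>p\<in>?O. ?f p)"
    using fin by simp
  also have "(\<Sum>p\<in>?O. ?f p) = (\<Sum>p\<in>?O. \<Sum>\<nu>=1..K. of_bool (p ^ \<nu> dvd n) * ln (real p))"
  proof (rule sum.cong[OF refl])
    fix p assume "p \<in> ?O"
    then have "?f p = (\<Sum>\<nu>=1..K. of_bool (p ^ \<nu> dvd n)) * ln (real p)"
      using assms by (simp only: sum_dvd_powers_eq_multiplicity mem_Collect_eq)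
    then show "?f p = (\<Sum>\<nu>=1..K. of_bool (p ^ \<nu> dvd n) * ln (real p))"
      by (simp only: sum_distrib_right)
  qed
  also have "\<dots> = (\<Sum>(p, \<nu>)\<in>odd_prime_exps_upto K. of_bool (p ^ \<nu> dvd n) * ln (real p))"
    unfolding odd_prime_exps_upto_def by (rule sum.cartesian_product)
  finally show ?thesis by simp
qed

section \<open>The factors of the normalization\<close>

lemma Pi_B_pos: "Pi_B B i > 0"
  by (auto simp: Pi_B_def intro!: prod_pos)

lemma F_fact_pos: "F_fact D > 0"
  by (auto simp: F_fact_def intro!: prod_pos)

lemma ln_Pi_B:
  assumes "2 * (B + i) + 1 \<le> K"
  shows "ln (real (Pi_B B i))
    = (\<Sum>(p, \<nu>)\<in>odd_prime_exps_upto K. 2 * real (N_KQ B (p ^ \<nu>) i) * ln (real p))"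
proof -
  have count: "(\<Sum>h=1..B. of_bool (Q dvd 2 * (h + i) + 1) :: real) = real (N_KQ B Q i)" for Q
  proof -
    have "{h\<in>{1..B}. Q dvd 2 * (h + i) + 1} = {h. 1 \<le> h \<and> h \<le> B \<and> Q dvd 2 * i + 2 * h + 1}"
      by (auto simp: algebra_simps)
    then show ?thesis
      by (simp add: N_KQ_def of_bool_def sum.If_cases Int_def)
  qed
  have "ln (real (Pi_B B i)) = (\<Sum>h=1..B. ln (real (2 * (h + i) + 1) ^ 2))"
    unfolding Pi_B_def of_nat_prod of_nat_power by (intro ln_prod) auto
  also have "\<dots> = 2 * (\<Sum>h=1..B. ln (real (2 * (h + i) + 1)))"
    unfolding sum_distrib_left by (intro sum.cong refl) (subst ln_realpow; simp)
  also have "(\<Sum>h=1..B. ln (real (2 * (h + i) + 1)))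
    = (\<Sum>h=1..B. \<Sum>(p, \<nu>)\<in>odd_prime_exps_upto K.
         of_bool (p ^ \<nu> dvd 2 * (h + i) + 1) * ln (real p))"
  proof (intro sum.cong refl)
    fix h assume "h \<in> {1..B}"
    then show "ln (real (2 * (h + i) + 1)) = (\<Sum>(p, \<nu>)\<in>odd_prime_exps_upto K.
         of_bool (p ^ \<nu> dvd 2 * (h + i) + 1) * ln (real p))"
      using assms ln_eq_sum_odd_prime_powers[of "2 * (h + i) + 1" K]
        not_dvd_imp_multiplicity_0[of 2 "2 * (h + i) + 1"] by simp
  qed
  also have "\<dots> = (\<Sum>(p, \<nu>)\<in>odd_prime_exps_upto K.
      (\<Sum>h=1..B. of_bool (p ^ \<nu> dvd 2 * (h + i) + 1)) * ln (real p))"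
    by (subst sum.swap) (simp only: sum_distrib_right case_prod_unfold)
  finally show ?thesis
    by (simp only: count sum_distrib_left case_prod_unfold mult.assoc)
qed

lemma card_multiples_upto:
  assumes "Q > 0"
  shows "(\<Sum>k=1..r. of_bool (Q dvd k) :: real) = real (r div Q)"
proof (induction r)
  case (Suc r)
  then show ?case by (auto simp: div_Suc dvd_eq_mod_eq_0)
qed simp

lemma ln_fact_odd_part:
  assumes "r \<le> K"
  shows "ln (real (fact r)) = real (multiplicity 2 (fact r :: nat)) * ln 2
    + (\<Sum>(p, \<nu>)\<in>odd_prime_exps_upto K. real (r div p ^ \<nu>) * ln (real p))"
proof -
  have mult: "multiplicity 2 (fact r :: nat) = (\<Sum>k=1..r. multiplicity 2 k)"
    unfolding fact_prod of_nat_id by (subst prime_elem_multiplicity_prod_distrib) auto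
  have "ln (real (fact r)) = (\<Sum>k=1..r. ln (real k))"
    unfolding fact_prod of_nat_prod of_nat_id by (intro ln_prod) auto
  also have "\<dots> = (\<Sum>k=1..r. real (multiplicity 2 k) * ln 2
      + (\<Sum>(p, \<nu>)\<in>odd_prime_exps_upto K. of_bool (p ^ \<nu> dvd k) * ln (real p)))"
    using assms by (intro sum.cong refl ln_eq_sum_odd_prime_powers) auto
  also have "\<dots> = real (multiplicity 2 (fact r :: nat)) * ln 2
      + (\<Sum>k=1..r. \<Sum>(p, \<nu>)\<in>odd_prime_exps_upto K. of_bool (p ^ \<nu> dvd k) * ln (real p))"
    by (simp only: mult sum.distrib of_nat_sum sum_distrib_right)
  also have "(\<Sum>k=1..r. \<Sum>(p, \<nu>)\<in>odd_prime_exps_upto K. of_bool (p ^ \<nu> dvd k) * ln (real p))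
    = (\<Sum>(p, \<nu>)\<in>odd_prime_exps_upto K. (\<Sum>k=1..r. of_bool (p ^ \<nu> dvd k)) * ln (real p))"
    by (subst sum.swap) (simp only: sum_distrib_right case_prod_unfold)
  also have "\<dots> = (\<Sum>(p, \<nu>)\<in>odd_prime_exps_upto K. real (r div p ^ \<nu>) * ln (real p))"
  proof (rule sum.cong[OF refl], clarify)
    fix p \<nu> assume "(p, \<nu>) \<in> odd_prime_exps_upto K"
    then have "p ^ \<nu> > 0" by (auto simp: odd_prime_exps_upto_def prime_gt_0_nat)
    then show "(\<Sum>k=1..r. of_bool (p ^ \<nu> dvd k)) * ln (real p) = real (r div p ^ \<nu>) * ln (real p)"
      by (simp only: card_multiples_upto)
  qed
  finally show ?thesis .
qed

lemma multiplicity_F_fact: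
  "multiplicity 2 (F_fact D) = (\<Sum>r<D. multiplicity 2 (fact r :: nat))"
  unfolding F_fact_def by (subst prime_elem_multiplicity_prod_distrib) auto

lemma ln_F_fact:
  assumes "D \<le> K"
  shows "ln (real (F_fact D)) = real (multiplicity 2 (F_fact D)) * ln 2
    + (\<Sum>(p, \<nu>)\<in>odd_prime_exps_upto K. real (Phi_Q (p ^ \<nu>) D) * ln (real p))"
proof -
  have "ln (real (F_fact D)) = (\<Sum>r<D. ln (real (fact r)))"
    unfolding F_fact_def of_nat_prod by (intro ln_prod) auto
  also have "\<dots> = (\<Sum>r<D. real (multiplicity 2 (fact r :: nat)) * ln 2
      + (\<Sum>(p, \<nu>)\<in>odd_prime_exps_upto K. real (r div p ^ \<nu>) * ln (real p)))"
    using assms by (intro sum.cong refl ln_fact_odd_part) auto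
  also have "\<dots> = real (multiplicity 2 (F_fact D)) * ln 2
      + (\<Sum>r<D. \<Sum>(p, \<nu>)\<in>odd_prime_exps_upto K. real (r div p ^ \<nu>) * ln (real p))"
    by (simp only: multiplicity_F_fact sum.distrib of_nat_sum sum_distrib_right)
  also have "(\<Sum>r<D. \<Sum>(p, \<nu>)\<in>odd_prime_exps_upto K. real (r div p ^ \<nu>) * ln (real p))
    = (\<Sum>(p, \<nu>)\<in>odd_prime_exps_upto K. real (Phi_Q (p ^ \<nu>) D) * ln (real p))"
    by (subst sum.swap)
      (simp only: sum_distrib_right case_prod_unfold Phi_Q_def of_nat_sum)
  finally show ?thesis .
qed

text \<open>The exponents \<open>a_Q\<close> are made so that they cancel the odd part of the normalization
  \<open>F_D / \<Prod> \<Pi>_i\<close>.\<close>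

lemma sum_a_Q:
  assumes "2 * (N_BS B S + B) \<le> K"
  shows "(\<Sum>(p, \<nu>)\<in>odd_prime_exps_upto K. real_of_int (a_Q B S (p ^ \<nu>)) * ln (real p))
    = (\<Sum>i<N_BS B S. ln (real (Pi_B B i))) - ln (real (F_fact (2 * B)))
      + real (multiplicity 2 (F_fact (2 * B))) * ln 2"
proof -
  have "(\<Sum>i<N_BS B S. ln (real (Pi_B B i)))
    = (\<Sum>i<N_BS B S. \<Sum>(p, \<nu>)\<in>odd_prime_exps_upto K.
         2 * real (N_KQ B (p ^ \<nu>) i) * ln (real p))"
    using assms by (intro sum.cong refl ln_Pi_B) auto
  also have "\<dots> = (\<Sum>(p, \<nu>)\<in>odd_prime_exps_upto K.
      (2 * (\<Sum>i<N_BS B S. real (N_KQ B (p ^ \<nu>) i))) * ln (real p))"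
    by (subst sum.swap) (simp only: sum_distrib_right sum_distrib_left case_prod_unfold)
  finally have "(\<Sum>i<N_BS B S. ln (real (Pi_B B i)))
    = (\<Sum>(p, \<nu>)\<in>odd_prime_exps_upto K.
        (2 * (\<Sum>i<N_BS B S. real (N_KQ B (p ^ \<nu>) i))) * ln (real p))" .
  then show ?thesis
    using ln_F_fact[of "2 * B" K] assms
    by (simp add: a_Q_def case_prod_unfold left_diff_distrib sum_subtractf)
qed

lemma infsum_odd_prime_exps:
  fixes f :: "nat \<Rightarrow> real"
  assumes "\<And>Q. Q > K \<Longrightarrow> f Q = 0"
  shows "(\<Sum>\<^sub>\<infinity>(p, \<nu>)\<in>odd_prime_exps. f (p ^ \<nu>) * ln (real p))
    = (\<Sum>(p, \<nu>)\<in>odd_prime_exps_upto K. f (p ^ \<nu>) * ln (real p))"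
proof -
  have "f (p ^ \<nu>) = 0"
    if "(p, \<nu>) \<in> odd_prime_exps" "(p, \<nu>) \<notin> odd_prime_exps_upto K" for p \<nu>
  proof (rule assms)
    have p2: "p \<ge> 2" and \<nu>: "\<nu> \<ge> 1"
      using that prime_ge_2_nat by (auto simp: odd_prime_exps_def)
    have "p \<le> p ^ \<nu>" using p2 \<nu> by (intro self_le_power) auto
    moreover have "\<nu> < p ^ \<nu>" using p2 by (intro power_gt_expt) auto
    ultimately show "K < p ^ \<nu>"
      using that by (auto simp: odd_prime_exps_def odd_prime_exps_upto_def)
  qed
  then have "(\<Sum>\<^sub>\<infinity>(p, \<nu>)\<in>odd_prime_exps. f (p ^ \<nu>) * ln (real p))
    = (\<Sum>\<^sub>\<infinity>(p, \<nu>)\<in>odd_prime_exps_upto K. f (p ^ \<nu>) * ln (real p))"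
    by (intro infsum_cong_neutral) (fastforce simp: odd_prime_exps_def odd_prime_exps_upto_def)+
  then show ?thesis by simp
qed

lemma eval_real_smult: "eval_real (Polynomial.smult c f) x = of_rat c * eval_real f x"
  unfolding eval_real_def by (subst map_poly_smult) (simp_all add: of_rat_mult)

lemma ln_abs_q_hat:
  assumes s: "s \<in> {1, -1}" and nz: "eval_real (det (R_mat B S A)) x \<noteq> 0"
  shows "ln \<bar>eval_real (q_hat s B S A) x\<bar>
    = ln (real (F_fact (2 * B))) - (\<Sum>i<N_BS B S. ln (real (Pi_B B i)))
      + ln \<bar>eval_real (det (R_mat B S A)) x\<bar>"
proof -
  let ?P = "\<Prod>i<N_BS B S. real (Pi_B B i)"
  have P: "?P > 0" by (intro prod_pos) (simp add: Pi_B_pos)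
  have F: "real (F_fact (2 * B)) > 0" by (simp add: F_fact_pos)
  have s1: "\<bar>of_rat s :: real\<bar> = 1" using s by (auto simp: of_rat_minus)
  have "(of_rat (\<Prod>i<N_BS B S. of_nat (Pi_B B i)) :: real) = ?P"
    by (simp add: of_rat_prod)
  then have "\<bar>eval_real (q_hat s B S A) x\<bar>
    = real (F_fact (2 * B)) / ?P * \<bar>eval_real (det (R_mat B S A)) x\<bar>"
    using P F s1
    by (simp add: q_hat_def eval_real_smult of_rat_mult of_rat_divide abs_mult
        del: of_nat_prod)
  also have "ln \<dots> = ln (real (F_fact (2 * B))) - ln ?P
      + ln \<bar>eval_real (det (R_mat B S A)) x\<bar>"
    using F nz ln_divide_pos[OF F P] divide_pos_pos[OF F P]
    by (subst ln_mult_pos) (simp_all del: of_nat_prod prod_pos_nat_iff)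
  also have "ln ?P = (\<Sum>i<N_BS B S. ln (real (Pi_B B i)))"
    by (intro ln_prod) (simp_all add: Pi_B_pos)
  finally show ?thesis .
qed

lemma log_q_hat_identity:
  assumes A: "A \<subseteq> {0..S + 2}" and s: "s \<in> {1, -1}"
    and nz: "eval_real (det (R_mat B S A)) x \<noteq> 0"
  shows "(\<Sum>\<^sub>\<infinity>(p, \<nu>)\<in>odd_prime_exps.
        real_of_int (a_Q B S (p ^ \<nu>) - m_AQ B S A (p ^ \<nu>)) * ln (real p))
      + ln \<bar>eval_real (q_hat s B S A) x\<bar>
    = ln \<bar>eval_real (det (R_mat B S A)) x\<bar>
      + real (multiplicity 2 (F_fact (2 * B))) * ln 2
      - (\<Sum>\<^sub>\<infinity>(p, \<nu>)\<in>odd_prime_exps. real_of_int (m_AQ B S A (p ^ \<nu>)) * ln (real p))"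
proof -
  \<comment> \<open>Beyond this bound both \<open>a_Q\<close> and \<open>m_Q\<close> vanish.\<close>
  define K where "K = 2 * N_BS B S + 2 * B + 2 * S"
  have m: "m_AQ B S A Q = 0" if "Q > K" for Q
    using that A by (intro m_AQ_eq_0) (simp_all add: K_def)
  have a: "a_Q B S Q = 0" if "Q > K" for Q
    using that by (intro a_Q_eq_0) (simp add: K_def)
  have sum_m: "(\<Sum>\<^sub>\<infinity>(p, \<nu>)\<in>odd_prime_exps. real_of_int (m_AQ B S A (p ^ \<nu>)) * ln (real p))
    = (\<Sum>(p, \<nu>)\<in>odd_prime_exps_upto K. real_of_int (m_AQ B S A (p ^ \<nu>)) * ln (real p))"
    using m by (intro infsum_odd_prime_exps) simp
  have "(\<Sum>\<^sub>\<infinity>(p, \<nu>)\<in>odd_prime_exps.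
      real_of_int (a_Q B S (p ^ \<nu>) - m_AQ B S A (p ^ \<nu>)) * ln (real p))
    = (\<Sum>(p, \<nu>)\<in>odd_prime_exps_upto K.
      real_of_int (a_Q B S (p ^ \<nu>) - m_AQ B S A (p ^ \<nu>)) * ln (real p))"
    using a m by (intro infsum_odd_prime_exps) simp
  also have "\<dots>
    = (\<Sum>(p, \<nu>)\<in>odd_prime_exps_upto K. real_of_int (a_Q B S (p ^ \<nu>)) * ln (real p))
      - (\<Sum>(p, \<nu>)\<in>odd_prime_exps_upto K. real_of_int (m_AQ B S A (p ^ \<nu>)) * ln (real p))"
    by (simp add: case_prod_unfold left_diff_distrib sum_subtractf)
  finally show ?thesis
    using sum_a_Q[of B S K] ln_abs_q_hat[OF s nz] sum_m by (simp add: K_def)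
qed

section \<open>The power of two in the superfactorial\<close>

lemma binary_digit_sum_even: "binary_digit_sum (2 * m) = binary_digit_sum m"
  by (cases "m = 0") (simp_all add: binary_digit_sum.simps[of "2 * m"])

lemma binary_digit_sum_odd: "binary_digit_sum (2 * m + 1) = binary_digit_sum m + 1"
  by (subst binary_digit_sum.simps) simp

text \<open>Adding \<open>1\<close> to \<open>r\<close> turns a block of trailing ones into zeros and one zero into a one; the length
  of that block is the exponent of \<open>2\<close> in \<open>r + 1\<close>.\<close>

lemma binary_digit_sum_Suc:
  "binary_digit_sum (Suc r) + multiplicity 2 (Suc r) = Suc (binary_digit_sum r)"
proof (induction r rule: less_induct)
  case (less r)
  show ?case
  proof (cases "even r")
    case True
    then obtain m where r: "r = 2 * m" by (rule evenE)
    have "multiplicity 2 (Suc r) = 0"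
      using True by (intro not_dvd_imp_multiplicity_0) simp
    then show ?thesis
      using binary_digit_sum_odd[of m] by (simp add: r binary_digit_sum_even)
  next
    case False
    then obtain m where r: "r = 2 * m + 1" by (rule oddE)
    have "multiplicity 2 (Suc r) = Suc (multiplicity 2 (Suc m))"
      using multiplicity_times_same[of "Suc m" "2::nat"] by (simp add: r)
    moreover have "binary_digit_sum (Suc r) = binary_digit_sum (Suc m)"
      using binary_digit_sum_even[of "Suc m"] by (simp add: r)
    ultimately show ?thesis
      using less.IH[of m] binary_digit_sum_odd[of m] by (simp add: r)
  qed
qed

lemma multiplicity_2_fact: "multiplicity 2 (fact r :: nat) + binary_digit_sum r = r"
proof (induction r)
  case 0
  show ?case by (simp add: binary_digit_sum.simps)
next
  case (Suc r)
  have "multiplicity 2 (fact (Suc r) :: nat) = multiplicity 2 (Suc r) + multiplicity 2 (fact r :: nat)"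
    unfolding fact_Suc of_nat_id by (intro prime_elem_multiplicity_mult_distrib) auto
  then show ?case using Suc binary_digit_sum_Suc[of r] by simp
qed

text \<open>Among all numbers with a given digit sum \<open>d\<close>, the smallest is \<open>2 ^ d - 1\<close>.\<close>

lemma power_binary_digit_sum_le: "2 ^ binary_digit_sum r \<le> r + 1"
proof (induction r rule: less_induct)
  case (less r)
  show ?case
  proof (cases "even r")
    case True
    then obtain m where r: "r = 2 * m" by (rule evenE)
    show ?thesis
    proof (cases "m = 0")
      case False
      then show ?thesis
        using less.IH[of m] by (simp add: r binary_digit_sum_even)
    qed (simp add: r binary_digit_sum.simps)
  next
    case False
    then obtain m where r: "r = 2 * m + 1" by (rule oddE)
    have "2 ^ binary_digit_sum r = 2 * 2 ^ binary_digit_sum m"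
      unfolding r binary_digit_sum_odd by simp
    also have "\<dots> \<le> 2 * (m + 1)"
      using less.IH[of m] by (simp add: r)
    finally show ?thesis by (simp add: r)
  qed
qed

lemma multiplicity_F_fact_digit_sums:
  "int (multiplicity 2 (F_fact D)) = (\<Sum>r<D. int r - int (binary_digit_sum r))"
  unfolding multiplicity_F_fact of_nat_sum
proof (intro sum.cong refl)
  fix r
  show "int (multiplicity 2 (fact r :: nat)) = int r - int (binary_digit_sum r)"
    using multiplicity_2_fact[of r] by linarith
qed

lemma multiplicity_F_fact_bound:
  assumes "B > 0"
  shows "\<bar>real (multiplicity 2 (F_fact (2 * B))) - 2 * (real B)\<^sup>2\<bar>
    \<le> real B + 2 * real B * log 2 (2 * real B)"
proof -
  let ?s = "\<lambda>r. real (binary_digit_sum r)"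
  have "real (multiplicity 2 (F_fact (2 * B))) = real_of_int (int (multiplicity 2 (F_fact (2 * B))))"
    by simp
  also have "\<dots> = (\<Sum>r<2 * B. real r) - (\<Sum>r<2 * B. ?s r)"
    unfolding multiplicity_F_fact_digit_sums by (simp add: sum_subtractf)
  also have "(\<Sum>r<2 * B. real r) = 2 * (real B)\<^sup>2 - real B"
    by (induction B) (simp_all add: power2_eq_square algebra_simps)
  finally have eq: "real (multiplicity 2 (F_fact (2 * B))) - 2 * (real B)\<^sup>2
    = - (real B + (\<Sum>r<2 * B. ?s r))" by simp
  have "?s r \<le> log 2 (2 * real B)" if "r < 2 * B" for r
  proof -
    have "2 ^ binary_digit_sum r \<le> 2 * B"
      using power_binary_digit_sum_le[of r] that by linarith
    then have "real (2 ^ binary_digit_sum r) \<le> real (2 * B)"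
      by (rule of_nat_mono)
    then show ?thesis using assms by (simp add: le_log_iff powr_realpow)
  qed
  then have "(\<Sum>r<2 * B. ?s r) \<le> (\<Sum>r<2 * B. log 2 (2 * real B))"
    by (intro sum_mono) simp
  moreover have "(\<Sum>r<2 * B. ?s r) \<ge> 0" by (intro sum_nonneg) simp
  ultimately show ?thesis unfolding eq by simp
qed

lemma multiplicity_F_fact_asymp:
  "(\<lambda>B. real (multiplicity 2 (F_fact (2 * B))) - 2 * (real B)\<^sup>2) \<in> O(\<lambda>B. real B * ln (real B))"
proof (rule bigoI[where c = "3 + 2 / ln 2"], rule eventually_mono[OF eventually_ge_at_top[of 3]])
  \<comment> \<open>From \<open>3 > e\<close> on, \<open>ln B \<ge> 1\<close>, so that the linear terms \<open>B + 2 B\<close> are absorbed.\<close>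
  fix B :: nat assume B: "B \<ge> 3"
  have "exp 1 \<le> real B" using exp_le B by linarith
  then have ln1: "1 \<le> ln (real B)" using B by (simp add: ln_ge_iff)
  have "real B + 2 * real B * log 2 (2 * real B) = 3 * real B + 2 / ln 2 * (real B * ln (real B))"
    using B by (simp add: log_def ln_mult field_simps)
  also have "\<dots> \<le> 3 * (real B * ln (real B)) + 2 / ln 2 * (real B * ln (real B))"
    using mult_left_mono[OF ln1, of "real B"] by simp
  also have "\<dots> = (3 + 2 / ln 2) * norm (real B * ln (real B))"
    using ln1 by (simp add: distrib_right)
  finally show "norm (real (multiplicity 2 (F_fact (2 * B))) - 2 * (real B)\<^sup>2)
      \<le> (3 + 2 / ln 2) * norm (real B * ln (real B))"
    using multiplicity_F_fact_bound[of B] B by simp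
qed

theorem mainTheorem5:
  "(\<forall>B S :: nat. \<forall>A :: nat set. \<forall>s :: rat.
      B > S \<and> S > 0 \<and> A \<subseteq> {0..S + 2} \<and> card A = S \<and> s \<in> {1, -1} \<and>
      eval_real (det (R_mat B S A)) catalan_const \<noteq> 0 \<longrightarrow>
      (\<Sum>\<^sub>\<infinity>(p, \<nu>)\<in>odd_prime_exps.
          real_of_int (a_Q B S (p ^ \<nu>) - m_AQ B S A (p ^ \<nu>)) * ln (real p))
        + ln \<bar>eval_real (q_hat s B S A) catalan_const\<bar>
      = ln \<bar>eval_real (det (R_mat B S A)) catalan_const\<bar>
        + real (multiplicity 2 (F_fact (2 * B))) * ln 2
        - (\<Sum>\<^sub>\<infinity>(p, \<nu>)\<in>odd_prime_exps. real_of_int (m_AQ B S A (p ^ \<nu>)) * ln (real p)))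
   \<and> (\<forall>B :: nat. B > 0 \<longrightarrow>
        int (multiplicity 2 (F_fact (2 * B))) = (\<Sum>r<2 * B. int r - int (binary_digit_sum r)))
   \<and> (\<lambda>B :: nat. real (multiplicity 2 (F_fact (2 * B))) - 2 * (real B)\<^sup>2)
        \<in> O(\<lambda>B. real B * ln (real B))
   \<and> (\<lambda>B :: nat. real (multiplicity 2 (F_fact (2 * B))) * ln 2 - (2 * ln 2) * (real B)\<^sup>2)
        \<in> O(\<lambda>B. real B * ln (real B))"
proof (intro conjI allI impI)
  fix B S :: nat and A :: "nat set" and s :: rat
  assume "B > S \<and> S > 0 \<and> A \<subseteq> {0..S + 2} \<and> card A = S \<and> s \<in> {1, -1} \<and>
      eval_real (det (R_mat B S A)) catalan_const \<noteq> 0"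
  then show "(\<Sum>\<^sub>\<infinity>(p, \<nu>)\<in>odd_prime_exps.
          real_of_int (a_Q B S (p ^ \<nu>) - m_AQ B S A (p ^ \<nu>)) * ln (real p))
        + ln \<bar>eval_real (q_hat s B S A) catalan_const\<bar>
      = ln \<bar>eval_real (det (R_mat B S A)) catalan_const\<bar>
        + real (multiplicity 2 (F_fact (2 * B))) * ln 2
        - (\<Sum>\<^sub>\<infinity>(p, \<nu>)\<in>odd_prime_exps. real_of_int (m_AQ B S A (p ^ \<nu>)) * ln (real p))"
    by (intro log_q_hat_identity) auto
next
  fix B :: nat
  show "int (multiplicity 2 (F_fact (2 * B))) = (\<Sum>r<2 * B. int r - int (binary_digit_sum r))"
    by (rule multiplicity_F_fact_digit_sums)
next
  show "(\<lambda>B :: nat. real (multiplicity 2 (F_fact (2 * B))) - 2 * (real B)\<^sup>2)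
        \<in> O(\<lambda>B. real B * ln (real B))"
    by (rule multiplicity_F_fact_asymp)
next
  have "(\<lambda>B. ln 2 * (real (multiplicity 2 (F_fact (2 * B))) - 2 * (real B)\<^sup>2))
        \<in> O(\<lambda>B. real B * ln (real B))"
    using multiplicity_F_fact_asymp by simp
  then show "(\<lambda>B :: nat. real (multiplicity 2 (F_fact (2 * B))) * ln 2 - (2 * ln 2) * (real B)\<^sup>2)
        \<in> O(\<lambda>B. real B * ln (real B))"
    by (simp add: algebra_simps)
qed

end
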